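(* Let $N\in\mathbb{N}$, $\mu\ge 0$, $\kappa>0$, and let $(\rho_i,\rho_i u_i)_{i=1,\dots,N}$, with $\rho_i>0$, be a differentiable-in-time solution, on some time interval, of the semidiscrete one-dimensional Navier-Stokes-Korteweg scheme with periodic boundary conditions given in the context, with numerical dissipation parameter $\lambda=\frac12\max_{i=1,\dots,N}\{|u_i|+\sqrt{p'(\rho_i)}\}$. Then the scheme dissipates the total discrete energy $$E_{\mathrm{NSK}}[\rho,\rho u]=\frac1N\sum_{i=1}^N E_i,\qquad E_i=\frac12\rho_i u_i^2+P(\rho_i)+\frac{\kappa}{2}(\nabla^+_x\rho_i)^2 .$$ In particular, the inequality $$\frac{d}{dt}E_{\mathrm{NSK}}[\rho,\rho u]\le \frac1N\left(-\mu\sum_{i=1}^N(\nabla^+_x u_i)^2-\kappa\sum_{i=1}^N\lambda h(\Delta_h\rho_i)^2\right)\le 0$$ holds on this time interval.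
   Context: Grid and operators: $h=1/N$. Grid functions $\phi=(\phi_i)$ are periodic: $\phi_{i+N}=\phi_i$ for all $i\in\mathbb{Z}$. Define $$\nabla^c_x\phi_i=\frac{\phi_{i+1}-\phi_{i-1}}{2h},\quad \nabla^+_x\phi_i=\frac{\phi_{i+1}-\phi_i}{h},\quad \nabla^-_x\phi_i=\frac{\phi_i-\phi_{i-1}}{h},\quad \Delta_h\phi_i=\frac{\phi_{i+1}-2\phi_i+\phi_{i-1}}{h^2}.$$ Data: $p$ is a continuously differentiable, strictly monotone pressure function on $(0,\infty)$ such that the first order part of the system is strictly hyperbolic (i.e. $p'>0$); $P$ is any potential energy, i.e. any function on $(0,\infty)$ with $P'(\rho)\rho-P(\rho)=p(\rho)$ (such $P$ is convex); $\mu\ge0$ is the constant viscosity and $\kappa>0$ the constant capillarity coefficient. Scheme (the unknowns are the functions of time $\rho_i>0$ and $\rho_i u_i$, $i=1,\dots,N$): $$-\frac{d}{dt}\rho_i=\nabla^c_x(\rho_i u_i)-\lambda h\,\Delta_h\rho_i,$$ $$-\frac{d}{dt}(\rho_i u_i)=\nabla^c_x(\rho_i u_i^2)+\nabla^c_x p(\rho_i)-\lambda h\,\Delta_h(\rho_i u_i)-\mu\,\Delta_h u_i-\kappa\,\nabla^-_x\left[\frac{\rho_{i+1}\Delta_h\rho_i+\rho_i\Delta_h\rho_{i+1}}{2}-\frac12(\nabla^+_x\rho_i)^2\right],$$ where $\lambda$ is evaluated at each time from the current values of $\rho_i,u_i$ and is independent of $i$. *)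

theory Defs
  imports "HOL-Analysis.Analysis"
begin

text \<open>
  A grid function on the uniform periodic grid with \<open>N\<close> cells is a map \<open>int \<Rightarrow> real\<close> of
  period \<open>N\<close>; the finite differences below only carry their intended (periodic) meaning
  on such maps.
\<close>

type_synonym grid_fun = "int \<Rightarrow> real"

definition grid_periodic :: "nat \<Rightarrow> grid_fun \<Rightarrow> bool" where
  "grid_periodic N \<phi> \<longleftrightarrow> (\<forall>i. \<phi> (i + int N) = \<phi> i)"

definition mesh :: "nat \<Rightarrow> real" where
  "mesh N = 1 / real N"

definition diff_c :: "nat \<Rightarrow> grid_fun \<Rightarrow> grid_fun" where
  "diff_c N \<phi> i = (\<phi> (i + 1) - \<phi> (i - 1)) / (2 * mesh N)"

definition diff_p :: "nat \<Rightarrow> grid_fun \<Rightarrow> grid_fun" where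
  "diff_p N \<phi> i = (\<phi> (i + 1) - \<phi> i) / mesh N"

definition diff_m :: "nat \<Rightarrow> grid_fun \<Rightarrow> grid_fun" where
  "diff_m N \<phi> i = (\<phi> i - \<phi> (i - 1)) / mesh N"

definition laplace_h :: "nat \<Rightarrow> grid_fun \<Rightarrow> grid_fun" where
  "laplace_h N \<phi> i = (\<phi> (i + 1) - 2 * \<phi> i + \<phi> (i - 1)) / (mesh N)\<^sup>2"

text \<open>
  Positivity of \<open>deriv p\<close> is strict hyperbolicity of the first order part, whose
  characteristic speeds are \<open>u - sqrt (p' \<rho>)\<close> and \<open>u + sqrt (p' \<rho>)\<close>.
\<close>

definition pressure_law :: "(real \<Rightarrow> real) \<Rightarrow> bool" where
  "pressure_law p \<longleftrightarrow>
     p C1_differentiable_on {0<..} \<and> strict_mono_on {0<..} p \<and> (\<forall>r>0. deriv p r > 0)"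

definition potential_energy :: "(real \<Rightarrow> real) \<Rightarrow> (real \<Rightarrow> real) \<Rightarrow> bool" where
  "potential_energy p P \<longleftrightarrow>
     (\<forall>r>0. P field_differentiable at r \<and> deriv P r * r - P r = p r)"

definition dissipation_speed :: "nat \<Rightarrow> (real \<Rightarrow> real) \<Rightarrow> grid_fun \<Rightarrow> grid_fun \<Rightarrow> real" where
  "dissipation_speed N p \<rho> u =
     1/2 * Max ((\<lambda>i. \<bar>u i\<bar> + sqrt (deriv p (\<rho> i))) ` {1..int N})"

definition capillary_flux :: "nat \<Rightarrow> grid_fun \<Rightarrow> grid_fun" where
  "capillary_flux N \<rho> i =
     (\<rho> (i + 1) * laplace_h N \<rho> i + \<rho> i * laplace_h N \<rho> (i + 1)) / 2
       - 1/2 * (diff_p N \<rho> i)\<^sup>2"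

text \<open>
  The right-hand sides of the equations for \<open>- d/dt \<rho> i\<close> and \<open>- d/dt (\<rho> i * u i)\<close>;
  \<open>l\<close> is the numerical dissipation parameter.
\<close>

definition mass_rhs :: "nat \<Rightarrow> real \<Rightarrow> grid_fun \<Rightarrow> grid_fun \<Rightarrow> grid_fun" where
  "mass_rhs N l \<rho> u i =
     diff_c N (\<lambda>j. \<rho> j * u j) i - l * mesh N * laplace_h N \<rho> i"

definition momentum_rhs ::
  "nat \<Rightarrow> (real \<Rightarrow> real) \<Rightarrow> real \<Rightarrow> real \<Rightarrow> real \<Rightarrow> grid_fun \<Rightarrow> grid_fun \<Rightarrow> grid_fun" where
  "momentum_rhs N p \<mu> \<kappa> l \<rho> u i =
     diff_c N (\<lambda>j. \<rho> j * (u j)\<^sup>2) i + diff_c N (\<lambda>j. p (\<rho> j)) i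
       - l * mesh N * laplace_h N (\<lambda>j. \<rho> j * u j) i
       - \<mu> * laplace_h N u i
       - \<kappa> * diff_m N (capillary_flux N \<rho>) i"

text \<open>
  Solutions on a time interval \<open>T\<close>. The state is given by density \<open>\<rho>\<close> and velocity \<open>u\<close>,
  but the evolved unknowns, i.e. those required to be differentiable, are \<open>\<rho>\<close> and
  \<open>\<rho> * u\<close>. Derivatives are one-sided at end points of \<open>T\<close> that belong to \<open>T\<close>.
\<close>

definition NSK_solution ::
  "nat \<Rightarrow> (real \<Rightarrow> real) \<Rightarrow> real \<Rightarrow> real \<Rightarrow> (real \<Rightarrow> real) \<Rightarrow> real set
     \<Rightarrow> (real \<Rightarrow> grid_fun) \<Rightarrow> (real \<Rightarrow> grid_fun) \<Rightarrow> bool" where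
  "NSK_solution N p \<mu> \<kappa> lam T \<rho> u \<longleftrightarrow>
     (\<forall>t\<in>T. grid_periodic N (\<rho> t) \<and> grid_periodic N (u t) \<and>
       (\<forall>i\<in>{1..int N}.
          \<rho> t i > 0 \<and>
          ((\<lambda>s. \<rho> s i) has_real_derivative - mass_rhs N (lam t) (\<rho> t) (u t) i)
            (at t within T) \<and>
          ((\<lambda>s. \<rho> s i * u s i) has_real_derivative
             - momentum_rhs N p \<mu> \<kappa> (lam t) (\<rho> t) (u t) i) (at t within T)))"

definition energy_NSK ::
  "nat \<Rightarrow> (real \<Rightarrow> real) \<Rightarrow> real \<Rightarrow> grid_fun \<Rightarrow> grid_fun \<Rightarrow> real" where
  "energy_NSK N P \<kappa> \<rho> u =
     1 / real N * (\<Sum>i=1..int N. 1/2 * \<rho> i * (u i)\<^sup>2 + P (\<rho> i) + \<kappa> / 2 * (diff_p N \<rho> i)\<^sup>2)"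

end

theory Submission
  imports Defs
begin

text \<open>
  Differentiating the energy pairs the scheme with the entropy variables
  \<open>(P'(\<rho>) - u\<^sup>2/2 - \<kappa> \<Delta>\<^sub>h \<rho>, u)\<close>. The central capillary flux satisfies
  \<open>\<nabla>\<^sup>-F = \<rho> \<nabla>\<^sup>c \<Delta>\<^sub>h \<rho>\<close>, so its work against \<open>u\<close> cancels the capillary part of the mass
  equation by summation by parts, leaving the two dissipation terms of the estimate. The Euler part
  is a sum over cell interfaces of the entropy production of the Lax-Friedrichs flux, each term
  of which is nonpositive by convexity of \<open>P\<close> and \<open>\<lambda> \<ge> max \<bar>u\<bar> / 2\<close>.
\<close>

section \<open>Periodic grid functions\<close>

lemma mesh_pos: "N \<ge> 1 \<Longrightarrow> mesh N > 0"
  by (simp add: mesh_def)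

lemma grid_periodic_shift:
  "grid_periodic N \<phi> \<Longrightarrow> grid_periodic N (\<lambda>i. \<phi> (i + c))"
  unfolding grid_periodic_def by (metis add.assoc add.commute)

lemma grid_periodic_shift_minus:
  "grid_periodic N \<phi> \<Longrightarrow> grid_periodic N (\<lambda>i. \<phi> (i - c))"
  using grid_periodic_shift[of N \<phi> "- c"] by simp

lemma grid_periodic_map2:
  "grid_periodic N \<phi> \<Longrightarrow> grid_periodic N \<psi> \<Longrightarrow> grid_periodic N (\<lambda>i. f (\<phi> i) (\<psi> i))"
  by (simp add: grid_periodic_def)

lemma grid_periodic_diff_c: "grid_periodic N \<phi> \<Longrightarrow> grid_periodic N (diff_c N \<phi>)"
  using grid_periodic_map2[OF grid_periodic_shift[of N \<phi> 1] grid_periodic_shift_minus[of N \<phi> 1],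
      of "\<lambda>x y. (x - y) / (2 * mesh N)"]
  by (simp add: diff_c_def[abs_def])

lemma grid_periodic_laplace_h: "grid_periodic N \<phi> \<Longrightarrow> grid_periodic N (laplace_h N \<phi>)"
  using grid_periodic_map2[OF grid_periodic_map2[OF grid_periodic_shift[of N \<phi> 1], of \<phi> "\<lambda>x y. x - 2 * y"]
      grid_periodic_shift_minus[of N \<phi> 1], of "\<lambda>x y. (x + y) / (mesh N)\<^sup>2"]
  by (simp add: laplace_h_def[abs_def])

lemma grid_periodic_mass_rhs:
  assumes "grid_periodic N \<rho>" "grid_periodic N u"
  shows "grid_periodic N (mass_rhs N l \<rho> u)"
proof -
  note m = grid_periodic_map2[OF assms, of "(*)"]
  show ?thesis
    using grid_periodic_map2[OF grid_periodic_diff_c[OF m] grid_periodic_laplace_h[OF assms(1)],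
        of "\<lambda>x y. x - l * mesh N * y"]
    by (simp add: mass_rhs_def[abs_def])
qed

lemma grid_periodic_add_mult:
  assumes "grid_periodic N \<phi>"
  shows "\<phi> (i + k * int N) = \<phi> i"
proof -
  have nat: "\<phi> (j + int n * int N) = \<phi> j" for j n
  proof (induction n)
    case (Suc n)
    have "\<phi> (j + int (Suc n) * int N) = \<phi> ((j + int n * int N) + int N)"
      by (simp add: algebra_simps)
    then show ?case using assms Suc by (simp add: grid_periodic_def)
  qed simp
  show ?thesis
  proof (cases "k \<ge> 0")
    case True
    then show ?thesis using nat[of i "nat k"] by simp
  next
    case False
    then show ?thesis using nat[of "i + k * int N" "nat (- k)"] by (simp add: algebra_simps)
  qed
qed

text \<open>One \<open>j\<close> must serve all periodic functions at once, so that
  \<open>\<rho>\<close>, \<open>u\<close> and the right-hand sides can be moved into the cell range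
  together.\<close>

lemma grid_index_representative:
  assumes "N \<ge> 1"
  obtains j where "j \<in> {1..int N}" "\<And>\<phi>. grid_periodic N \<phi> \<Longrightarrow> \<phi> i = \<phi> j"
proof
  \<comment> \<open>Shifting by one before and after \<open>mod\<close> puts the residue in 1..N
    rather than 0..N-1.\<close>
  let ?j = "(i - 1) mod int N + 1"
  have "0 \<le> (i - 1) mod int N" "(i - 1) mod int N < int N"
    using assms by simp_all
  then show "?j \<in> {1..int N}"
    unfolding atLeastAtMost_iff by linarith
  fix \<phi> :: grid_fun
  assume "grid_periodic N \<phi>"
  moreover have "i = ?j + (i - 1) div int N * int N"
    using div_mult_mod_eq[of "i - 1" "int N"] by simp
  ultimately show "\<phi> i = \<phi> ?j"
    using grid_periodic_add_mult by metis
qed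

section \<open>Summation by parts over one period\<close>

lemma sum_periodic_telescope:
  assumes "grid_periodic N G"
  shows "(\<Sum>i=1..int N. G (i + 1) - G i) = 0"
proof -
  have "(\<Sum>i=1..int N. G (i + 1)) = (\<Sum>i=2..int N + 1. G i)"
    by (rule sum.reindex_bij_witness[of _ "\<lambda>i. i - 1" "\<lambda>i. i + 1"]) auto
  moreover have "(\<Sum>i=2..int N + 1. G i) + G 1 = (\<Sum>i=1..int N + 1. G i)"
  proof -
    have "{1..int N + 1} = insert 1 {2..int N + 1}" by auto
    then show ?thesis by simp
  qed
  moreover have "(\<Sum>i=1..int N. G i) + G (int N + 1) = (\<Sum>i=1..int N + 1. G i)"
  proof -
    have "{1..int N + 1} = insert (int N + 1) {1..int N}" by auto
    then show ?thesis by simp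
  qed
  moreover have "G (int N + 1) = G 1"
    using assms unfolding grid_periodic_def by (metis add.commute)
  ultimately show ?thesis by (simp add: sum_subtractf)
qed

text \<open>Each summation by parts below reduces to exhibiting its boundary term \<open>G\<close>,
  whose total contribution vanishes by periodicity.\<close>

lemma sum_eq_if_telescoping:
  fixes f g :: grid_fun
  assumes "grid_periodic N G" "\<And>i. f i = g i + (G (i + 1) - G i)"
  shows "(\<Sum>i=1..int N. f i) = (\<Sum>i=1..int N. g i)"
  by (simp add: assms(2) sum.distrib sum_periodic_telescope[OF assms(1)])

context
  fixes N :: nat and \<phi> \<psi> :: grid_fun
  assumes N: "N \<ge> 1" and \<phi>: "grid_periodic N \<phi>" and \<psi>: "grid_periodic N \<psi>"
begin

text \<open>The right-hand side lives on the interface between cells \<open>i\<close> and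
  \<open>i + 1\<close>, the form in which the Euler fluxes can be estimated one interface at a
  time.\<close>

lemma sum_by_parts_diff_c:
  "(\<Sum>i=1..int N. \<phi> i * diff_c N \<psi> i) = (\<Sum>i=1..int N. - diff_p N \<phi> i * ((\<psi> i + \<psi> (i + 1)) / 2))"
proof (rule sum_eq_if_telescoping)
  show "grid_periodic N (\<lambda>i. \<phi> i * (\<psi> (i - 1) + \<psi> i) / (2 * mesh N))"
    using grid_periodic_map2[OF \<phi> grid_periodic_map2[OF grid_periodic_shift_minus[OF \<psi>, of 1] \<psi>, of "(+)"],
        of "\<lambda>x y. x * y / (2 * mesh N)"] .
qed (use mesh_pos[OF N] in \<open>simp add: diff_p_def diff_c_def field_simps\<close>)

lemma diff_c_antisymmetric:
  "(\<Sum>i=1..int N. \<phi> i * diff_c N \<psi> i) = (\<Sum>i=1..int N. - diff_c N \<phi> i * \<psi> i)"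
proof (rule sum_eq_if_telescoping)
  note 1 = grid_periodic_map2[OF \<phi> grid_periodic_shift_minus[OF \<psi>, of 1], of "(*)"]
  note 2 = grid_periodic_map2[OF grid_periodic_shift_minus[OF \<phi>, of 1] \<psi>, of "(*)"]
  show "grid_periodic N (\<lambda>i. (\<phi> i * \<psi> (i - 1) + \<phi> (i - 1) * \<psi> i) / (2 * mesh N))"
    using grid_periodic_map2[OF 1 2, of "\<lambda>x y. (x + y) / (2 * mesh N)"] .
qed (use mesh_pos[OF N] in \<open>simp add: diff_c_def field_simps\<close>)

lemma sum_by_parts_laplace_h:
  "(\<Sum>i=1..int N. \<phi> i * laplace_h N \<psi> i) = (\<Sum>i=1..int N. - diff_p N \<phi> i * diff_p N \<psi> i)"
proof (rule sum_eq_if_telescoping)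
  show "grid_periodic N (\<lambda>i. \<phi> i * (\<psi> i - \<psi> (i - 1)) / (mesh N)\<^sup>2)"
    using grid_periodic_map2[OF \<phi> grid_periodic_map2[OF \<psi> grid_periodic_shift_minus[OF \<psi>, of 1], of "(-)"],
        of "\<lambda>x y. x * y / (mesh N)\<^sup>2"] .
qed (use mesh_pos[OF N] in \<open>simp add: diff_p_def laplace_h_def field_simps power2_eq_square\<close>)

end

section \<open>The capillary flux\<close>

text \<open>Discrete counterpart of
  \<open>\<partial>\<^sub>x (\<rho> \<rho>\<^sub>x\<^sub>x - \<rho>\<^sub>x\<^sup>2 / 2) = \<rho> \<rho>\<^sub>x\<^sub>x\<^sub>x\<close>.\<close>

lemma diff_m_capillary_flux:
  assumes "N \<ge> 1"
  shows "diff_m N (capillary_flux N \<rho>) i = \<rho> i * diff_c N (laplace_h N \<rho>) i"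
proof -
  define h where "h = mesh N"
  have h: "h > 0" using mesh_pos[OF assms] by (simp add: h_def)
  define L where "L = laplace_h N \<rho>"
  have L: "L i = (\<rho> (i + 1) - 2 * \<rho> i + \<rho> (i - 1)) / h\<^sup>2"
    by (simp add: L_def laplace_h_def h_def)
  \<comment> \<open>Difference of squares: the two slopes differ by \<open>h * L i\<close> and add
    up to \<open>(\<rho> (i + 1) - \<rho> (i - 1)) / h\<close>.\<close>
  have sq: "((\<rho> (i + 1) - \<rho> i) / h)\<^sup>2 - ((\<rho> i - \<rho> (i - 1)) / h)\<^sup>2
      = (\<rho> (i + 1) - \<rho> (i - 1)) * L i"
    unfolding L using h by (simp add: field_simps power2_eq_square)
  have "diff_m N (capillary_flux N \<rho>) i
      = ((\<rho> (i + 1) * L i + \<rho> i * L (i + 1)) / 2 - (\<rho> i * L (i - 1) + \<rho> (i - 1) * L i) / 2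
        - 1/2 * (((\<rho> (i + 1) - \<rho> i) / h)\<^sup>2 - ((\<rho> i - \<rho> (i - 1)) / h)\<^sup>2)) / h"
    by (simp add: diff_m_def capillary_flux_def diff_p_def L_def h_def algebra_simps)
  \<comment> \<open>By \<open>sq\<close>, the squared slopes cancel both products containing
    \<open>L i\<close>; only the neighbours \<open>L (i + 1)\<close> and \<open>L (i - 1)\<close>
    survive.\<close>
  also have "\<dots> = \<rho> i * ((L (i + 1) - L (i - 1)) / (2 * h))"
    unfolding sq using h by (simp add: field_simps)
  finally show ?thesis by (simp add: diff_c_def L_def h_def)
qed

section \<open>Convexity of the potential energy and pressure jumps\<close>

context
  fixes p P :: "real \<Rightarrow> real"
  assumes p: "pressure_law p" and P: "potential_energy p P"
begin

lemma potential_energy_has_derivative: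
  "r > 0 \<Longrightarrow> (P has_real_derivative deriv P r) (at r)"
  using P by (simp add: potential_energy_def DERIV_deriv_iff_field_differentiable)

lemma pressure_law_has_derivative:
  assumes "r > 0"
  shows "(p has_real_derivative deriv p r) (at r)"
proof -
  have "p differentiable at r"
    using p assms by (auto simp: pressure_law_def C1_differentiable_on_eq)
  then show ?thesis
    by (simp add: DERIV_deriv_iff_real_differentiable)
qed

text \<open>\<open>P'' = p' / \<rho>\<close>, although only first differentiability of \<open>P\<close> is assumed.\<close>

lemma deriv_potential_energy_mono:
  assumes "0 < a" "a \<le> b"
  shows "deriv P a \<le> deriv P b"
proof (rule DERIV_nonneg_imp_nondecreasing[OF assms(2)])
  fix r assume "a \<le> r" "r \<le> b"
  then have r: "r > 0" using assms by simp
  \<comment> \<open>Solving the defining identity for \<open>deriv P\<close> turns it into a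
    quotient of differentiable functions.\<close>
  have eq: "(P s + p s) / s = deriv P s" if "s > 0" for s
    using P that by (auto simp: potential_energy_def field_simps)
  have "((\<lambda>s. (P s + p s) / s) has_real_derivative
      ((deriv P r + deriv p r) * r - (P r + p r) * 1) / (r * r)) (at r)"
    using r by (intro DERIV_divide DERIV_add potential_energy_has_derivative
        pressure_law_has_derivative DERIV_ident) auto
  moreover have "((deriv P r + deriv p r) * r - (P r + p r) * 1) / (r * r) = deriv p r / r"
    using eq[OF r, symmetric] r by (simp add: field_simps)
  ultimately have "(deriv P has_real_derivative deriv p r / r) (at r)"
    using has_field_derivative_transform_within_open[of _ _ r "{0<..}" "deriv P"] eq r by auto
  moreover have "deriv p r / r \<ge> 0"
    using p r by (simp add: pressure_law_def less_imp_le)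
  ultimately show "\<exists>y. (deriv P has_real_derivative y) (at r) \<and> y \<ge> 0" by blast
qed

text \<open>Since \<open>p r = deriv P r * r - P r\<close>, the pressure jump is the jump of
  \<open>deriv P r * r\<close> minus that of \<open>P\<close>, and the tangent inequalities of
  convexity at \<open>a\<close> and \<open>b\<close> bound the latter.\<close>

lemma pressure_jump_bounds:
  assumes "0 < a" "a \<le> b"
  shows "a * (deriv P b - deriv P a) \<le> p b - p a"
    and "p b - p a \<le> b * (deriv P b - deriv P a)"
proof -
  have "deriv P a * (b - a) \<le> P b - P a \<and> P b - P a \<le> deriv P b * (b - a)"
  proof (cases "a = b")
    case False
    then have "a < b" using assms by simp
    then obtain z where z: "a < z" "z < b" "P b - P a = (b - a) * deriv P z"
      using MVT2[of a b P "deriv P"] potential_energy_has_derivative assms by force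
    then have "deriv P a \<le> deriv P z" "deriv P z \<le> deriv P b"
      using deriv_potential_energy_mono assms by auto
    then show ?thesis
      using z \<open>a < b\<close> by (simp add: mult.commute)
  qed simp
  moreover have "p a = deriv P a * a - P a" "p b = deriv P b * b - P b"
    using P assms by (auto simp: potential_energy_def)
  ultimately show "a * (deriv P b - deriv P a) \<le> p b - p a"
    "p b - p a \<le> b * (deriv P b - deriv P a)"
    by (simp_all add: algebra_simps)
qed

text \<open>The previous bounds put the pressure jump in an interval with this midpoint and
  half-width. Swapping \<open>a\<close> and \<open>b\<close> changes only the sign inside the
  absolute value, so their order is immaterial.\<close>

lemma pressure_jump_midpoint:
  assumes "0 < a" "0 < b"
  shows "\<bar>(a + b) / 2 * (deriv P b - deriv P a) - (p b - p a)\<bar>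
    \<le> (deriv P b - deriv P a) * (b - a) / 2"
proof (cases "a \<le> b")
  case True
  then show ?thesis
    using pressure_jump_bounds[OF assms(1) True] unfolding abs_le_iff
    by (simp add: field_simps)
next
  case False
  then show ?thesis
    using pressure_jump_bounds[of b a] assms unfolding abs_le_iff
    by (simp add: field_simps)
qed

end

section \<open>Entropy production at a single interface\<close>

text \<open>
  Tadmor's entropy stability condition for the local Lax-Friedrichs flux, with entropy variables
  \<open>(P'(\<rho>) - u\<^sup>2/2, u)\<close> and entropy potential \<open>p(\<rho>) u\<close>; \<open>qa\<close>, \<open>qb\<close> stand for the values of
  \<open>P'\<close> and \<open>pa\<close>, \<open>pb\<close> for those of \<open>p\<close>. Since \<open>\<bar>v + w\<bar>/4 + \<bar>w - v\<bar>/4 = max \<bar>v\<bar> \<bar>w\<bar> / 2\<close>, the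
  velocity part of the numerical dissipation alone suffices.
\<close>

lemma lax_friedrichs_entropy_stable:
  fixes a b v w qa qb pa pb l :: real
  assumes "a > 0" "b > 0"
    and mid: "\<bar>(a + b) / 2 * (qb - qa) - (pb - pa)\<bar> \<le> (qb - qa) * (b - a) / 2"
    and "\<bar>v\<bar> \<le> 2 * l" "\<bar>w\<bar> \<le> 2 * l"
  shows "((qb - w\<^sup>2/2) - (qa - v\<^sup>2/2)) * ((a * v + b * w) / 2)
      + (w - v) * ((a * v\<^sup>2 + b * w\<^sup>2) / 2 + (pa + pb) / 2) - (pb * w - pa * v)
    \<le> l * (((qb - w\<^sup>2/2) - (qa - v\<^sup>2/2)) * (b - a) + (w - v) * (b * w - a * v))"
proof -
  \<comment> \<open>In terms of averages \<open>U\<close>, \<open>R\<close> and jumps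
    \<open>d\<close>, \<open>J\<close>, the left side is \<open>U * K + A * d / 4\<close> plus a
    multiple of \<open>d\<^sup>2\<close>, and the right side is \<open>l * A\<close> plus a multiple
    of \<open>d\<^sup>2\<close>. The two parts are compared separately.\<close>
  define A K U d R J where "A = (qb - qa) * (b - a)" and "K = (a + b) / 2 * (qb - qa) - (pb - pa)"
    and "U = (v + w) / 2" and "d = w - v" and "R = (a + b) / 2" and "J = b - a"
  have K: "\<bar>K\<bar> \<le> A / 2" using mid by (simp add: A_def K_def)
  then have A: "A \<ge> 0" by linarith
  have "\<bar>v + w\<bar> + \<bar>w - v\<bar> \<le> 4 * l"
    using assms(4,5) by linarith
  then have l: "\<bar>U\<bar> / 2 + \<bar>d\<bar> / 4 \<le> l"
    by (simp add: U_def d_def)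
  have R: "R > 0"
    using assms(1,2) by (simp add: R_def)
  have J: "\<bar>J\<bar> \<le> 2 * R"
    using assms(1,2) by (auto simp: R_def J_def abs_if)
  have "U * K \<le> \<bar>U\<bar> * (A / 2)"
    using mult_mono[OF order_refl K, of "\<bar>U\<bar>"] abs_ge_self[of "U * K"] by (simp add: abs_mult)
  moreover have "A * d \<le> A * \<bar>d\<bar>"
    using A by (simp add: mult_left_mono)
  moreover have "A * (\<bar>U\<bar> / 2 + \<bar>d\<bar> / 4) \<le> A * l"
    using A l by (rule mult_left_mono[rotated])
  ultimately have 1: "U * K + A * d / 4 \<le> l * A"
    by (simp add: algebra_simps)
  \<comment> \<open>Positivity of the densities bounds the jump \<open>J\<close> by
    \<open>2 * R\<close>, so the same lower bound on \<open>l\<close> also settles the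
    \<open>d\<^sup>2\<close> part.\<close>
  have "U * J \<le> \<bar>U\<bar> * (2 * R)"
    using mult_mono[OF order_refl J, of "\<bar>U\<bar>"] abs_ge_self[of "U * J"] by (simp add: abs_mult)
  moreover have "R * d \<le> R * \<bar>d\<bar>"
    using R by simp
  moreover have "R * (\<bar>U\<bar> / 2 + \<bar>d\<bar> / 4) \<le> R * l"
    using R l by simp
  ultimately have "(R * d + U * J) / 4 \<le> R * l"
    by (simp add: algebra_simps)
  then have 2: "d\<^sup>2 * ((R * d + U * J) / 4) \<le> d\<^sup>2 * (R * l)"
    by (rule mult_left_mono) simp
  have "((qb - w\<^sup>2/2) - (qa - v\<^sup>2/2)) * ((a * v + b * w) / 2)
      + (w - v) * ((a * v\<^sup>2 + b * w\<^sup>2) / 2 + (pa + pb) / 2) - (pb * w - pa * v)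
    = U * K + A * d / 4 + d\<^sup>2 * ((R * d + U * J) / 4)"
    unfolding A_def K_def U_def d_def R_def J_def
    by (simp add: field_simps power2_eq_square)
  moreover have "l * (((qb - w\<^sup>2/2) - (qa - v\<^sup>2/2)) * (b - a) + (w - v) * (b * w - a * v))
      = l * A + d\<^sup>2 * (R * l)"
    unfolding A_def d_def R_def
    by (simp add: field_simps power2_eq_square)
  ultimately show ?thesis using 1 2 by linarith
qed

section \<open>The energy estimate at a fixed time\<close>

text \<open>The differential of N times the energy in the conserved variables
  \<open>(\<rho>, \<rho> * u)\<close> along \<open>(a, b)\<close>, with the capillary term still in
  the form before summation by parts.\<close>

definition energy_rate ::
  "nat \<Rightarrow> (real \<Rightarrow> real) \<Rightarrow> real \<Rightarrow> grid_fun \<Rightarrow> grid_fun \<Rightarrow> grid_fun \<Rightarrow> grid_fun \<Rightarrow> real" where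
  "energy_rate N P \<kappa> \<rho> u a b = (\<Sum>i=1..int N.
     (deriv P (\<rho> i) - (u i)\<^sup>2 / 2) * a i + u i * b i + \<kappa> * (diff_p N \<rho> i * diff_p N a i))"

text \<open>The viscous and capillary contributions are computed exactly; the only inequality is the
  sign of the Euler part.\<close>

lemma energy_rate_le:
  fixes \<rho> u :: grid_fun
  assumes N: "N \<ge> 1" and p: "pressure_law p" and P: "potential_energy p P"
    and \<rho>: "grid_periodic N \<rho>" and u: "grid_periodic N u"
    and pos: "\<And>i. \<rho> i > 0" and l: "\<And>i. \<bar>u i\<bar> \<le> 2 * l"
  shows "energy_rate N P \<kappa> \<rho> u (\<lambda>i. - mass_rhs N l \<rho> u i) (\<lambda>i. - momentum_rhs N p \<mu> \<kappa> l \<rho> u i)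
    \<le> - \<mu> * (\<Sum>i=1..int N. (diff_p N u i)\<^sup>2)
       - \<kappa> * (\<Sum>i=1..int N. l * mesh N * (laplace_h N \<rho> i)\<^sup>2)"
proof -
  define h where "h = mesh N"
  have h: "h > 0" using mesh_pos[OF N] by (simp add: h_def)
  define V m f q L where "V i = deriv P (\<rho> i) - (u i)\<^sup>2 / 2" and "m i = \<rho> i * u i"
    and "f i = \<rho> i * (u i)\<^sup>2" and "q i = p (\<rho> i)" and "L = laplace_h N \<rho>" for i
  define a where "a i = - mass_rhs N l \<rho> u i" for i
  have V: "grid_periodic N V" and m: "grid_periodic N m" and f: "grid_periodic N f"
    and q: "grid_periodic N q" and L: "grid_periodic N L" and a: "grid_periodic N a"
    using \<rho> u grid_periodic_laplace_h[OF \<rho>] grid_periodic_mass_rhs[OF \<rho> u, of l]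
    by (simp_all add: grid_periodic_def V_def m_def f_def q_def L_def a_def)
  have a_eq: "a i = - diff_c N m i + l * h * L i" for i
    by (simp add: a_def mass_rhs_def m_def[abs_def] L_def h_def)
  have b_eq: "- momentum_rhs N p \<mu> \<kappa> l \<rho> u i = - diff_c N f i - diff_c N q i
      + l * h * laplace_h N m i + \<mu> * laplace_h N u i + \<kappa> * (\<rho> i * diff_c N L i)" for i
    by (simp add: momentum_rhs_def diff_m_capillary_flux[OF N] m_def[abs_def] f_def[abs_def]
        q_def[abs_def] L_def h_def)
  \<comment> \<open>Inserting the mass equation for \<open>a\<close> gives two terms: the transport
    term is the negative of the work of the capillary force in the momentum equation, and the
    numerical diffusion gives the capillary dissipation.\<close>
  have korteweg: "(\<Sum>i=1..int N. diff_p N \<rho> i * diff_p N a i)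
      = - (\<Sum>i=1..int N. m i * diff_c N L i) - (\<Sum>i=1..int N. l * h * (L i)\<^sup>2)"
  proof -
    have "(\<Sum>i=1..int N. diff_p N \<rho> i * diff_p N a i) = - (\<Sum>i=1..int N. a i * L i)"
      using sum_by_parts_laplace_h[OF N a \<rho>] by (simp add: sum_negf L_def mult.commute)
    also have "(\<Sum>i=1..int N. a i * L i)
        = (\<Sum>i=1..int N. - diff_c N m i * L i) + (\<Sum>i=1..int N. l * h * (L i)\<^sup>2)"
      by (simp add: a_eq sum.distrib[symmetric] algebra_simps power2_eq_square)
    also have "(\<Sum>i=1..int N. - diff_c N m i * L i) = (\<Sum>i=1..int N. m i * diff_c N L i)"
      using diff_c_antisymmetric[OF N m L] by simp
    finally show ?thesis by simp
  qed
  have viscous: "(\<Sum>i=1..int N. u i * laplace_h N u i) = - (\<Sum>i=1..int N. (diff_p N u i)\<^sup>2)"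
    using sum_by_parts_laplace_h[OF N u u] by (simp add: sum_negf power2_eq_square)
  define euler where "euler = (\<Sum>i=1..int N. - (V i * diff_c N m i) - u i * diff_c N f i - u i * diff_c N q i
      + l * h * (V i * L i) + l * h * (u i * laplace_h N m i))"
  define avg where "avg \<phi> i = (\<phi> i + \<phi> (i + 1)) / 2" for \<phi> :: grid_fun and i
  have "euler = (\<Sum>i=1..int N. diff_p N V i * avg m i + diff_p N u i * avg f i + diff_p N u i * avg q i
      - l * h * (diff_p N V i * diff_p N \<rho> i) - l * h * (diff_p N u i * diff_p N m i))"
    unfolding euler_def sum.distrib sum_subtractf sum_negf
      sum_distrib_left[symmetric] L_def avg_def
    using sum_by_parts_diff_c[OF N V m] sum_by_parts_diff_c[OF N u f] sum_by_parts_diff_c[OF N u q]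
      sum_by_parts_laplace_h[OF N V \<rho>] sum_by_parts_laplace_h[OF N u m]
    by (simp add: sum_negf)
  \<comment> \<open>At each interface the net production is bounded by the jump of the entropy
    potential \<open>q i * u i\<close>, divided by \<open>h\<close>; these jumps telescope.\<close>
  also have "\<dots> \<le> (\<Sum>i=1..int N. (q (i + 1) * u (i + 1)) / h - (q i * u i) / h)"
  proof (rule sum_mono)
    fix i :: int
    let ?j = "i + 1"
    have "(V ?j - V i) * avg m i + (u ?j - u i) * (avg f i + avg q i) - (q ?j * u ?j - q i * u i)
        \<le> l * ((V ?j - V i) * (\<rho> ?j - \<rho> i) + (u ?j - u i) * (m ?j - m i))"
      unfolding V_def m_def f_def q_def avg_def
      by (rule lax_friedrichs_entropy_stable[OF pos pos pressure_jump_midpoint[OF p P pos pos] l l])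
    then have "((V ?j - V i) * avg m i + (u ?j - u i) * (avg f i + avg q i)
         - l * ((V ?j - V i) * (\<rho> ?j - \<rho> i) + (u ?j - u i) * (m ?j - m i))) / h
        \<le> (q ?j * u ?j - q i * u i) / h"
      using h by (intro divide_right_mono) auto
    moreover have "l * h * (x / h * (y / h)) = l * (x * y) / h" for x y
      using h by simp
    ultimately show "diff_p N V i * avg m i + diff_p N u i * avg f i + diff_p N u i * avg q i
      - l * h * (diff_p N V i * diff_p N \<rho> i) - l * h * (diff_p N u i * diff_p N m i)
      \<le> (q ?j * u ?j) / h - (q i * u i) / h"
      unfolding diff_p_def h_def[symmetric]
      by (simp add: add_divide_distrib diff_divide_distrib algebra_simps)
  qed
  also have "\<dots> = 0"
    using sum_periodic_telescope[OF grid_periodic_map2[OF q u, of "\<lambda>x y. x * y / h"]] .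
  finally have "euler \<le> 0" .
  moreover have "energy_rate N P \<kappa> \<rho> u a (\<lambda>i. - momentum_rhs N p \<mu> \<kappa> l \<rho> u i)
      = euler + \<mu> * (\<Sum>i=1..int N. u i * laplace_h N u i)
        + \<kappa> * (\<Sum>i=1..int N. m i * diff_c N L i)
        + \<kappa> * (\<Sum>i=1..int N. diff_p N \<rho> i * diff_p N a i)"
    unfolding energy_rate_def euler_def sum_distrib_left sum.distrib[symmetric] b_eq
    by (rule sum.cong) (simp_all add: V_def[symmetric] a_eq[of i for i] m_def algebra_simps)
  ultimately have "energy_rate N P \<kappa> \<rho> u a (\<lambda>i. - momentum_rhs N p \<mu> \<kappa> l \<rho> u i)
      \<le> - \<mu> * (\<Sum>i=1..int N. (diff_p N u i)\<^sup>2) - \<kappa> * (\<Sum>i=1..int N. l * h * (L i)\<^sup>2)"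
    unfolding korteweg viscous by (simp add: algebra_simps)
  then show ?thesis
    by (simp add: a_def[abs_def] L_def h_def)
qed

section \<open>Time derivative and monotonicity of the energy\<close>

text \<open>The density derivative is wanted beyond the cell range because \<open>diff_p\<close> at
  cell N reads cell N+1; the momentum enters only cell by cell.\<close>

lemma energy_NSK_has_derivative:
  fixes \<rho> u :: "real \<Rightarrow> grid_fun"
  assumes t: "t \<in> T" and p: "pressure_law p" and P: "potential_energy p P"
    and pos: "\<And>s i. s \<in> T \<Longrightarrow> \<rho> s i > 0"
    and a: "\<And>i. ((\<lambda>s. \<rho> s i) has_real_derivative a i) (at t within T)"
    and b: "\<And>i. i \<in> {1..int N} \<Longrightarrow> ((\<lambda>s. \<rho> s i * u s i) has_real_derivative b i) (at t within T)"
  shows "((\<lambda>s. energy_NSK N P \<kappa> (\<rho> s) (u s)) has_real_derivative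
    1 / real N * energy_rate N P \<kappa> (\<rho> t) (u t) a b) (at t within T)"
proof -
  have kinetic: "((\<lambda>s. 1/2 * \<rho> s i * (u s i)\<^sup>2) has_real_derivative
      u t i * b i - (u t i)\<^sup>2 / 2 * a i) (at t within T)" if i: "i \<in> {1..int N}" for i
  proof -
    have *: "2 * \<rho> t i \<noteq> 0"
      using pos[OF t, of i] by simp
    \<comment> \<open>Differentiability is given for \<open>\<rho>\<close> and
      \<open>\<rho> * u\<close>, not for \<open>u\<close>, so the kinetic energy is differentiated
      in conserved variables.\<close>
    have "((\<lambda>s. (\<rho> s i * u s i)\<^sup>2 / (2 * \<rho> s i)) has_real_derivative
        u t i * b i - (u t i)\<^sup>2 / 2 * a i) (at t within T)"
      using DERIV_divide[OF DERIV_power[OF b[OF i], of 2] DERIV_cmult[OF a[of i], of 2] *]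
      by (rule DERIV_cong) (use * in \<open>simp_all add: field_simps power2_eq_square\<close>)
    then show ?thesis
    proof (rule has_field_derivative_transform_within[OF _ zero_less_one t])
      fix s assume "s \<in> T"
      then show "(\<rho> s i * u s i)\<^sup>2 / (2 * \<rho> s i) = 1/2 * \<rho> s i * (u s i)\<^sup>2"
        using pos[of s i] by (simp add: field_simps power2_eq_square)
    qed
  qed
  have potential: "((\<lambda>s. P (\<rho> s i)) has_real_derivative deriv P (\<rho> t i) * a i) (at t within T)" for i
    using DERIV_chain2[OF potential_energy_has_derivative[OF p P pos[OF t]] a] .
  have capillary: "((\<lambda>s. \<kappa> / 2 * (diff_p N (\<rho> s) i)\<^sup>2) has_real_derivative
      \<kappa> * (diff_p N (\<rho> t) i * diff_p N a i)) (at t within T)" for i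
    unfolding diff_p_def
    using DERIV_cmult[OF DERIV_power[OF DERIV_cdivide[OF DERIV_diff[OF a[of "i + 1"] a[of i]],
        of "mesh N"], of 2], of "\<kappa> / 2"]
    by (rule DERIV_cong) simp
  show ?thesis
    unfolding energy_NSK_def energy_rate_def
  proof (intro DERIV_cmult DERIV_sum)
    fix i assume "i \<in> {1..int N}"
    from DERIV_add[OF DERIV_add[OF kinetic[OF this] potential] capillary]
    show "((\<lambda>s. 1/2 * \<rho> s i * (u s i)\<^sup>2 + P (\<rho> s i) + \<kappa> / 2 * (diff_p N (\<rho> s) i)\<^sup>2)
      has_real_derivative (deriv P (\<rho> t i) - (u t i)\<^sup>2 / 2) * a i + u t i * b i
        + \<kappa> * (diff_p N (\<rho> t) i * diff_p N a i)) (at t within T)"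
      by (rule DERIV_cong) (simp add: algebra_simps)
  qed
qed

text \<open>The mean value theorem on \<open>{s..t}\<close>: this segment lies in \<open>T\<close>,
  so derivatives within \<open>T\<close> restrict to it, including one-sided ones at end
  points.\<close>

lemma antimono_on_if_nonpos_derivative_within:
  fixes f :: "real \<Rightarrow> real"
  assumes "is_interval T"
    and "\<And>t. t \<in> T \<Longrightarrow> \<exists>D. (f has_real_derivative D) (at t within T) \<and> D \<le> 0"
  shows "antimono_on T f"
proof (rule monotone_onI)
  fix s t assume st: "s \<in> T" "t \<in> T" "s \<le> t"
  obtain D where D: "\<And>x. x \<in> T \<Longrightarrow> (f has_real_derivative D x) (at x within T) \<and> D x \<le> 0"
    using assms(2) by metis
  have sub: "{s..t} \<subseteq> T"
    using mem_is_interval_1_I[OF assms(1) st(1,2)] by auto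
  have "(f has_derivative (*) (D x)) (at x within {s..t})" if "s \<le> x" "x \<le> t" for x
    using D[of x, THEN conjunct1] sub that DERIV_subset[OF _ sub, of f "D x" x]
    by (simp add: has_field_derivative_def subset_iff)
  then have "\<exists>x\<in>{s..t}. f t - f s = D x * (t - s)"
    using mvt_very_simple[OF st(3), of f "\<lambda>x. (*) (D x)"] by auto
  then show "f t \<le> f s"
    using D sub st(3) by (smt (verit) subsetD mult_nonpos_nonneg)
qed

section \<open>From one period to all indices\<close>

text \<open>Periodicity moves \<open>i\<close> into the range of the maximum, and the nonnegative
  sound speed is dropped.\<close>

lemma dissipation_speed_ge:
  assumes N: "N \<ge> 1" and p: "pressure_law p" and u: "grid_periodic N u"
    and pos: "\<And>i. \<rho> i > 0"
  shows "\<bar>u i\<bar> \<le> 2 * dissipation_speed N p \<rho> u"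
proof -
  obtain j where j: "j \<in> {1..int N}" "u i = u j"
    using grid_index_representative[OF N] u by metis
  have "sqrt (deriv p (\<rho> j)) \<ge> 0"
    using p pos[of j] by (simp add: pressure_law_def less_imp_le)
  moreover have "\<bar>u j\<bar> + sqrt (deriv p (\<rho> j)) \<le> Max ((\<lambda>i. \<bar>u i\<bar> + sqrt (deriv p (\<rho> i))) ` {1..int N})"
    using j by (intro Max_ge) auto
  ultimately show ?thesis
    unfolding dissipation_speed_def j(2) by linarith
qed

text \<open>A solution is constrained only on 1..N. Its periodicity at every time of
  \<open>T\<close> identifies the whole trajectory at \<open>i\<close> with that at a representative
  cell, and the mass right-hand side is periodic too.\<close>

lemma NSK_solution_all_indices:
  assumes N: "N \<ge> 1" and sol: "NSK_solution N p \<mu> \<kappa> lam T \<rho> u" and t: "t \<in> T"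
  shows "\<rho> t i > 0"
    and "((\<lambda>s. \<rho> s i) has_real_derivative - mass_rhs N (lam t) (\<rho> t) (u t) i) (at t within T)"
proof -
  have per: "grid_periodic N (\<rho> s)" "grid_periodic N (u s)" if "s \<in> T" for s
    using sol that by (auto simp: NSK_solution_def)
  obtain j where j: "j \<in> {1..int N}" and eq: "\<And>\<phi>. grid_periodic N \<phi> \<Longrightarrow> \<phi> i = \<phi> j"
    using grid_index_representative[OF N, of i] by blast
  show "\<rho> t i > 0"
    using sol t j eq[OF per(1)[OF t]] by (simp add: NSK_solution_def)
  have "((\<lambda>s. \<rho> s j) has_real_derivative - mass_rhs N (lam t) (\<rho> t) (u t) j) (at t within T)"
    using sol t j by (simp add: NSK_solution_def)
  then show "((\<lambda>s. \<rho> s i) has_real_derivative - mass_rhs N (lam t) (\<rho> t) (u t) i) (at t within T)"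
    unfolding eq[OF grid_periodic_mass_rhs[OF per[OF t]]]
    by (rule has_field_derivative_transform_within[OF _ zero_less_one t]) (simp add: eq per(1))
qed

theorem theorem3:
  fixes N :: nat and \<mu> \<kappa> :: real and p P :: "real \<Rightarrow> real"
    and T :: "real set" and \<rho> u :: "real \<Rightarrow> int \<Rightarrow> real" and lam :: "real \<Rightarrow> real"
  assumes "N \<ge> 1" and "\<mu> \<ge> 0" and "\<kappa> > 0"
    and "pressure_law p" and "potential_energy p P"
    and "is_interval T" and "interior T \<noteq> {}"
    and "NSK_solution N p \<mu> \<kappa> lam T \<rho> u"
    and "\<And>t. t \<in> T \<Longrightarrow> lam t = dissipation_speed N p (\<rho> t) (u t)"
  shows "antimono_on T (\<lambda>t. energy_NSK N P \<kappa> (\<rho> t) (u t)) \<and>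
    (\<forall>t\<in>T. \<exists>D. ((\<lambda>s. energy_NSK N P \<kappa> (\<rho> s) (u s)) has_real_derivative D) (at t within T) \<and>
       D \<le> 1 / real N * (- \<mu> * (\<Sum>i=1..int N. (diff_p N (u t) i)\<^sup>2)
              - \<kappa> * (\<Sum>i=1..int N. lam t * mesh N * (laplace_h N (\<rho> t) i)\<^sup>2)) \<and>
       1 / real N * (- \<mu> * (\<Sum>i=1..int N. (diff_p N (u t) i)\<^sup>2)
              - \<kappa> * (\<Sum>i=1..int N. lam t * mesh N * (laplace_h N (\<rho> t) i)\<^sup>2)) \<le> 0)"
proof
  let ?E = "\<lambda>s. energy_NSK N P \<kappa> (\<rho> s) (u s)"
  let ?B = "\<lambda>t. 1 / real N * (- \<mu> * (\<Sum>i=1..int N. (diff_p N (u t) i)\<^sup>2)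
              - \<kappa> * (\<Sum>i=1..int N. lam t * mesh N * (laplace_h N (\<rho> t) i)\<^sup>2))"
  note N = assms(1) and \<mu> = assms(2) and \<kappa> = assms(3) and p = assms(4) and P = assms(5)
    and sol = assms(8) and lam = assms(9)
  note pos = NSK_solution_all_indices(1)[OF N sol]
  show *: "\<forall>t\<in>T. \<exists>D. (?E has_real_derivative D) (at t within T) \<and> D \<le> ?B t \<and> ?B t \<le> 0"
  proof
    fix t assume t: "t \<in> T"
    have per: "grid_periodic N (\<rho> t)" "grid_periodic N (u t)"
      using sol t by (auto simp: NSK_solution_def)
    have speed: "\<bar>u t i\<bar> \<le> 2 * lam t" for i
      using dissipation_speed_ge[OF N p per(2) pos[OF t]] lam[OF t] by simp
    \<comment> \<open>Any index would do: an absolute value is bounded by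
      \<open>2 * lam t\<close>.\<close>
    then have "lam t \<ge> 0"
      using abs_ge_zero[of "u t 0"] speed[of 0] by linarith
    then have "\<mu> * (\<Sum>i=1..int N. (diff_p N (u t) i)\<^sup>2) \<ge> 0"
      "\<kappa> * (\<Sum>i=1..int N. lam t * mesh N * (laplace_h N (\<rho> t) i)\<^sup>2) \<ge> 0"
      using \<mu> \<kappa> mesh_pos[OF N] by (auto intro!: mult_nonneg_nonneg sum_nonneg)
    then have B: "?B t \<le> 0"
      by (intro mult_nonneg_nonpos) auto
    have D: "(?E has_real_derivative 1 / real N * energy_rate N P \<kappa> (\<rho> t) (u t)
        (\<lambda>i. - mass_rhs N (lam t) (\<rho> t) (u t) i)
        (\<lambda>i. - momentum_rhs N p \<mu> \<kappa> (lam t) (\<rho> t) (u t) i)) (at t within T)"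
      using sol t
      by (intro energy_NSK_has_derivative[OF t p P pos] NSK_solution_all_indices(2)[OF N sol t])
        (auto simp: NSK_solution_def)
    show "\<exists>D. (?E has_real_derivative D) (at t within T) \<and> D \<le> ?B t \<and> ?B t \<le> 0"
      using D B mult_left_mono[OF energy_rate_le[OF N p P per pos[OF t] speed], of "1 / real N"]
      by (intro exI conjI) auto
  qed
  show "antimono_on T ?E"
    by (rule antimono_on_if_nonpos_derivative_within[OF assms(6)]) (use * order_trans in blast)
qed

end
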